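(* Let $\alpha,\beta\in\mathbb{R}$ with $\alpha^2+\beta^2=1$ be such that the four numbers $1,\ \alpha^2-\beta^2,\ 2\alpha\beta,\ 0$ are pairwise distinct. Let $|0\rangle,|1\rangle$ be the standard orthonormal basis of $\mathbb{C}^2$ and put $$|\phi_d\rangle=\alpha|0\rangle+\beta|1\rangle,\qquad |\phi_a^1\rangle=\alpha|0\rangle+\beta|1\rangle,\quad |\phi_a^2\rangle=\alpha|1\rangle+\beta|0\rangle,\quad |\phi_a^3\rangle=\alpha|0\rangle-\beta|1\rangle,\quad |\phi_a^4\rangle=\alpha|1\rangle-\beta|0\rangle .$$ Then there exists no device which, given a single copy of each of the two qubits $|\phi_a^i\rangle$ (with $i\in\{1,2,3,4\}$ unknown) and $|\phi_d\rangle$, calculates the inner product $\langle\phi_a^i|\phi_d\rangle$ for every $i=1,2,3,4$. That is, there do not exist a finite set $\Omega$, a POVM $(E_\omega)_{\omega\in\Omega}$ on $\mathbb{C}^2\otimes\mathbb{C}^2$ and a function $f:\Omega\to\mathbb{C}$ such that, for every $i\in\{1,2,3,4\}$, $$\sum_{\omega\in\Omega:\ f(\omega)=\langle\phi_a^i|\phi_d\rangle}\big(\langle\phi_a^i|\otimes\langle\phi_d|\big)\,E_\omega\,\big(|\phi_a^i\rangle\otimes|\phi_d\rangle\big)=1 .$$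
   Context: A POVM on a finite-dimensional Hilbert space $H$ with finite outcome set $\Omega$ is a family $(E_\omega)_{\omega\in\Omega}$ of positive semidefinite operators on $H$ with $\sum_{\omega}E_\omega=I$; measuring it on the pure state $|\psi\rangle$ (a unit vector) gives outcome $\omega$ with probability $\langle\psi|E_\omega|\psi\rangle$. A "device" is a physical procedure allowed by quantum mechanics which takes the joint input state $|\phi_a^i\rangle\otimes|\phi_d\rangle$ and returns a classical number, i.e. a POVM followed by a function $f$ of the outcome; it "calculates" a quantity if it returns the correct value with probability $1$. The numbers $\alpha,\beta$ are known, so the device may depend on them, but not on the index $i$. The values of the inner products are $\langle\phi_a^1|\phi_d\rangle=1$, $\langle\phi_a^2|\phi_d\rangle=2\alpha\beta$, $\langle\phi_a^3|\phi_d\rangle=\alpha^2-\beta^2$, $\langle\phi_a^4|\phi_d\rangle=0$. *)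

theory Defs
  imports "HOL-Analysis.Analysis"
begin

text \<open>The inner product is conjugate-linear in the first argument (bra-ket convention).\<close>

definition cinner :: "complex ^ 'n \<Rightarrow> complex ^ 'n \<Rightarrow> complex" where
  "cinner x y = (\<Sum>i\<in>UNIV. cnj (x $ i) * y $ i)"

text \<open>The tensor product of \<open>\<complex>\<^sup>m\<close> and \<open>\<complex>\<^sup>n\<close> is modelled by
  coordinates indexed by pairs, so that the products of the standard basis vectors
  are again the standard basis vectors.\<close>

definition tensor :: "complex ^ 'm \<Rightarrow> complex ^ 'n \<Rightarrow> complex ^ ('m \<times> 'n)" where
  "tensor x y = (\<chi> p. x $ fst p * y $ snd p)"

text \<open>Over the complex numbers, non-negativity of the quadratic form (which includes its
  being real) forces the matrix to be Hermitian, so this is not required separately.\<close>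

definition pos_semidef :: "complex ^ 'n ^ 'n \<Rightarrow> bool" where
  "pos_semidef A \<longleftrightarrow> (\<forall>v. cinner v (A *v v) \<in> \<real>\<^sub>\<ge>\<^sub>0)"

definition povm :: "'w set \<Rightarrow> ('w \<Rightarrow> complex ^ 'n ^ 'n) \<Rightarrow> bool" where
  "povm \<Omega> E \<longleftrightarrow> finite \<Omega> \<and> (\<forall>\<omega>\<in>\<Omega>. pos_semidef (E \<omega>)) \<and> (\<Sum>\<omega>\<in>\<Omega>. E \<omega>) = mat 1"

text \<open>The index type \<open>2\<close> has exactly the two elements \<open>1\<close> and \<open>2\<close>
  (where \<open>2 = 0\<close>); they label the basis vectors \<open>|0\<rangle>\<close> and
  \<open>|1\<rangle>\<close> respectively.\<close>

definition ket0 :: "complex ^ 2" where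
  "ket0 = axis 1 1"

definition ket1 :: "complex ^ 2" where
  "ket1 = axis 2 1"

definition phi_d :: "real \<Rightarrow> real \<Rightarrow> complex ^ 2" where
  "phi_d \<alpha> \<beta> = \<alpha> *\<^sub>R ket0 + \<beta> *\<^sub>R ket1"

text \<open>Only the indices 1, 2, 3, 4 are meaningful.\<close>

definition phi_a :: "real \<Rightarrow> real \<Rightarrow> nat \<Rightarrow> complex ^ 2" where
  "phi_a \<alpha> \<beta> i =
    (if i = 1 then \<alpha> *\<^sub>R ket0 + \<beta> *\<^sub>R ket1
     else if i = 2 then \<alpha> *\<^sub>R ket1 + \<beta> *\<^sub>R ket0
     else if i = 3 then \<alpha> *\<^sub>R ket0 - \<beta> *\<^sub>R ket1
     else \<alpha> *\<^sub>R ket1 - \<beta> *\<^sub>R ket0)"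

end

theory Submission
  imports Defs
begin

text \<open>Perfectly distinguishable states are orthogonal: if outcomes in two disjoint classes occur
  with certainty on unit vectors \<open>x\<close> and \<open>y\<close>, each \<open>E \<omega>\<close> has vanishing
  quadratic form at \<open>x\<close> or at \<open>y\<close>, hence \<open>\<langle>x|E \<omega>|y\<rangle> = 0\<close> by positivity, and
  summing over \<open>\<omega>\<close> gives \<open>\<langle>x|y\<rangle> = 0\<close>. The inputs with \<open>i = 1\<close> and \<open>i = 2\<close>
  have the distinct answers \<open>1\<close> and \<open>2\<alpha>\<beta>\<close>, but their overlap
  is \<open>2\<alpha>\<beta> \<noteq> 0\<close>.\<close>

lemma cinner_add_left: "cinner (x + y) z = cinner x z + cinner y z"
  by (simp add: cinner_def sum.distrib distrib_right)

lemma cinner_add_right: "cinner x (y + z) = cinner x y + cinner x z"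
  by (simp add: cinner_def sum.distrib distrib_left)

lemma cinner_scale_left: "cinner (c *s x) y = cnj c * cinner x y"
  by (simp add: cinner_def sum_distrib_left mult.assoc)

lemma cinner_scale_right: "cinner x (c *s y) = c * cinner x y"
  by (simp add: cinner_def sum_distrib_left mult.left_commute)

lemma cinner_tensor: "cinner (tensor a b) (tensor c d) = cinner a c * cinner b d"
  unfolding cinner_def tensor_def sum_product UNIV_Times_UNIV[symmetric] sum.cartesian_product
  by (intro sum.cong) (auto simp: mult_ac)

lemma cinner_sum_matrix:
  "finite S \<Longrightarrow> cinner x ((\<Sum>i\<in>S. E i) *v y) = (\<Sum>i\<in>S. cinner x (E i *v y))"
proof (induction S rule: finite_induct)
  case empty
  then show ?case by (simp add: cinner_def)
next
  case (insert i S)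
  then show ?case by (simp add: matrix_vector_mult_add_rdistrib cinner_add_right)
qed

text \<open>Completeness of the POVM in weak form. With \<open>x = y\<close> it gives the total
  probability; with \<open>x\<close> and \<open>y\<close> distinct it recovers their overlap from
  the individual effects.\<close>

lemma povm_sum_cinner:
  assumes "povm \<Omega> E"
  shows "(\<Sum>\<omega>\<in>\<Omega>. cinner x (E \<omega> *v y)) = cinner x y"
  using assms cinner_sum_matrix[of \<Omega> x E y] by (simp add: povm_def)

lemma affine_nonneg_imp_slope_zero:
  fixes a b :: real
  assumes "\<And>t. 0 \<le> a + t * b"
  shows "b = 0"
proof (rule ccontr)
  assume "b \<noteq> 0"
  \<comment> \<open>At this \<open>t\<close> the affine function takes the value -1.\<close>
  then show False using assms[of "- (a + 1) / b"] by simp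
qed

text \<open>Move \<open>y\<close> along \<open>x\<close>: by \<open>x0\<close> the term quadratic in
  the coefficient \<open>s\<close> drops out, and what remains is bounded below only if its part
  linear in \<open>s\<close> and \<open>cnj s\<close> vanishes. Both orders of the arguments come
  out at once, without first proving \<open>A\<close> Hermitian.\<close>

lemma pos_semidef_kernel:
  assumes psd: "pos_semidef A" and x0: "cinner x (A *v x) = 0"
  shows "cinner y (A *v x) = 0" and "cinner x (A *v y) = 0"
proof -
  define p where "p = cinner y (A *v x)"
  define r where "r = cinner x (A *v y)"
  define a where "a = cinner y (A *v y)"
  have nonneg: "a + (s * p + cnj s * r) \<in> \<real>\<^sub>\<ge>\<^sub>0" for s
  proof -
    have "cinner (y + s *s x) (A *v (y + s *s x)) = a + (s * p + cnj s * r)"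
      using x0
      by (simp add: matrix_vector_right_distrib vector_scalar_commute cinner_add_left
          cinner_add_right cinner_scale_left cinner_scale_right a_def p_def r_def)
    with psd show ?thesis unfolding pos_semidef_def by metis
  qed
  have zero: "s * p + cnj s * r = 0" for s
  proof -
    have scaled: "a + of_real t * (s * p + cnj s * r) \<in> \<real>\<^sub>\<ge>\<^sub>0" for t
      using nonneg[of "of_real t * s"] by (simp add: algebra_simps)
    have "Re (s * p + cnj s * r) = 0"
    proof (rule affine_nonneg_imp_slope_zero)
      show "0 \<le> Re a + t * Re (s * p + cnj s * r)" for t
        using scaled[of t] by (simp add: complex_nonneg_Reals_iff)
    qed
    \<comment> \<open>At \<open>t = 0\<close> the value is \<open>a\<close>, so \<open>a\<close> is
      real; at \<open>t = 1\<close> the whole sum is real.\<close>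
    moreover have "Im (s * p + cnj s * r) = 0"
      using scaled[of 0] scaled[of 1] by (simp add: complex_nonneg_Reals_iff)
    ultimately show ?thesis by (simp add: complex_eq_iff)
  qed
  \<comment> \<open>\<open>s = 1\<close> gives the sum; \<open>s = \<i>\<close> gives
    \<open>\<i> * (p - r) = 0\<close>.\<close>
  have "p + r = 0" and "p - r = 0"
    using zero[of 1] zero[of \<i>] by (simp_all add: complex_eq_iff)
  then show "cinner y (A *v x) = 0" and "cinner x (A *v y) = 0"
    unfolding p_def[symmetric] r_def[symmetric] by auto
qed

text \<open>The outcomes satisfying \<open>P\<close> already exhaust the total probability 1, so the
  remaining nonnegative terms sum to zero and vanish one by one.\<close>

lemma povm_certain_outcome:
  assumes E: "povm \<Omega> E" and unit: "cinner x x = 1"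
    and certain: "(\<Sum>\<omega> | \<omega> \<in> \<Omega> \<and> P \<omega>. cinner x (E \<omega> *v x)) = 1"
    and \<omega>: "\<omega> \<in> \<Omega>" "\<not> P \<omega>"
  shows "cinner x (E \<omega> *v x) = 0"
proof -
  let ?q = "\<lambda>\<omega>. cinner x (E \<omega> *v x)"
  have fin: "finite \<Omega>" and nonneg: "\<And>\<omega>. \<omega> \<in> \<Omega> \<Longrightarrow> ?q \<omega> \<in> \<real>\<^sub>\<ge>\<^sub>0"
    using E by (auto simp: povm_def pos_semidef_def)
  have "sum ?q \<Omega> = sum ?q {\<omega> \<in> \<Omega>. P \<omega>} + sum ?q {\<omega> \<in> \<Omega>. \<not> P \<omega>}"
    using fin by (subst sum.union_disjoint[symmetric]) (auto intro: sum.cong)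
  then have "sum ?q {\<omega> \<in> \<Omega>. \<not> P \<omega>} = 0"
    using povm_sum_cinner[OF E] unit certain by simp
  then have "(\<Sum>\<omega> | \<omega> \<in> \<Omega> \<and> \<not> P \<omega>. Re (?q \<omega>)) = 0"
    by (metis Re_sum zero_complex.sel(1))
  then have "Re (?q \<omega>) = 0"
    using fin nonneg \<omega> by (subst (asm) sum_nonneg_eq_0_iff) (auto simp: complex_nonneg_Reals_iff)
  with nonneg[OF \<omega>(1)] show ?thesis
    by (simp add: complex_nonneg_Reals_iff complex_eq_iff)
qed

lemma povm_distinguishes_imp_orthogonal:
  assumes E: "povm \<Omega> E" and unit: "cinner x x = 1" "cinner y y = 1"
    and x: "(\<Sum>\<omega> | \<omega> \<in> \<Omega> \<and> P \<omega>. cinner x (E \<omega> *v x)) = 1"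
    and y: "(\<Sum>\<omega> | \<omega> \<in> \<Omega> \<and> Q \<omega>. cinner y (E \<omega> *v y)) = 1"
    and disj: "\<And>\<omega>. \<omega> \<in> \<Omega> \<Longrightarrow> \<not> (P \<omega> \<and> Q \<omega>)"
  shows "cinner x y = 0"
proof -
  have "cinner x (E \<omega> *v y) = 0" if \<omega>: "\<omega> \<in> \<Omega>" for \<omega>
  proof -
    have psd: "pos_semidef (E \<omega>)" using E \<omega> by (simp add: povm_def)
    show ?thesis
    proof (cases "P \<omega>")
      case True
      then have "\<not> Q \<omega>" using disj \<omega> by blast
      then show ?thesis
        using pos_semidef_kernel(1)[OF psd] povm_certain_outcome[OF E unit(2) y \<omega>] by blast
    next
      case False
      then show ?thesis
        using pos_semidef_kernel(2)[OF psd] povm_certain_outcome[OF E unit(1) x \<omega>] by blast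
    qed
  qed
  then show ?thesis using povm_sum_cinner[OF E, of x y] by simp
qed

lemma cinner_qubit: "cinner x y = cnj (x $ 1) * y $ 1 + cnj (x $ 2) * y $ 2"
  for x y :: "complex ^ 2"
  by (simp add: cinner_def sum_2)

lemma phi_components:
  "phi_d \<alpha> \<beta> $ 1 = \<alpha>" "phi_d \<alpha> \<beta> $ 2 = \<beta>"
  "phi_a \<alpha> \<beta> 1 $ 1 = \<alpha>" "phi_a \<alpha> \<beta> 1 $ 2 = \<beta>"
  "phi_a \<alpha> \<beta> 2 $ 1 = \<beta>" "phi_a \<alpha> \<beta> 2 $ 2 = \<alpha>"
  by (simp_all add: phi_d_def phi_a_def ket0_def ket1_def axis_def of_real_def)

theorem lemma1:
  fixes \<alpha> \<beta> :: real
  assumes "\<alpha>^2 + \<beta>^2 = 1"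
    and "distinct [1, \<alpha>^2 - \<beta>^2, 2 * \<alpha> * \<beta>, 0]"
  shows "\<not> (\<exists>(\<Omega> :: 'w set) (E :: 'w \<Rightarrow> complex ^ (2 \<times> 2) ^ (2 \<times> 2)) (f :: 'w \<Rightarrow> complex).
      povm \<Omega> E \<and>
      (\<forall>i\<in>{1, 2, 3, 4}.
        (\<Sum>\<omega> | \<omega> \<in> \<Omega> \<and> f \<omega> = cinner (phi_a \<alpha> \<beta> i) (phi_d \<alpha> \<beta>).
          cinner (tensor (phi_a \<alpha> \<beta> i) (phi_d \<alpha> \<beta>))
            (E \<omega> *v tensor (phi_a \<alpha> \<beta> i) (phi_d \<alpha> \<beta>))) = 1))"
proof (intro notI, elim exE conjE)
  fix \<Omega> :: "'w set" and E :: "'w \<Rightarrow> complex ^ (2 \<times> 2) ^ (2 \<times> 2)" and f :: "'w \<Rightarrow> complex"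
  let ?d = "phi_d \<alpha> \<beta>" and ?a = "phi_a \<alpha> \<beta>"
  assume E: "povm \<Omega> E"
    and correct: "\<forall>i\<in>{1, 2, 3, 4}.
      (\<Sum>\<omega> | \<omega> \<in> \<Omega> \<and> f \<omega> = cinner (?a i) ?d.
        cinner (tensor (?a i) ?d) (E \<omega> *v tensor (?a i) ?d)) = 1"
  have one: "complex_of_real \<alpha> * \<alpha> + complex_of_real \<beta> * \<beta> = 1"
    using assms(1) unfolding of_real_mult[symmetric] of_real_add[symmetric]
    by (simp add: power2_eq_square)
  \<comment> \<open>\<open>One_nat_def\<close> would turn the index \<open>1\<close> of
    \<open>phi_a\<close> into \<open>Suc 0\<close>, and \<open>phi_components\<close> would no
    longer match.\<close>
  have unit: "cinner ?d ?d = 1" "cinner (?a 1) (?a 1) = 1" "cinner (?a 2) (?a 2) = 1"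
    using one by (simp_all add: cinner_qubit phi_components add.commute del: One_nat_def)
  have val1: "cinner (?a 1) ?d = 1"
    using one by (simp add: cinner_qubit phi_components del: One_nat_def)
  have val2: "cinner (?a 2) ?d = of_real (2 * \<alpha> * \<beta>)"
    by (simp add: cinner_qubit phi_components del: One_nat_def)
  have overlap: "cinner (?a 1) (?a 2) = of_real (2 * \<alpha> * \<beta>)"
    by (simp add: cinner_qubit phi_components del: One_nat_def)
  \<comment> \<open>The first inequality separates the two answers, the second makes the two inputs
    non-orthogonal.\<close>
  have ne: "2 * \<alpha> * \<beta> \<noteq> 1" "2 * \<alpha> * \<beta> \<noteq> 0"
    using assms(2) by auto
  have "cinner (tensor (?a 1) ?d) (tensor (?a 2) ?d) = 0"
  proof (rule povm_distinguishes_imp_orthogonal[OF E])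
    show "(\<Sum>\<omega> | \<omega> \<in> \<Omega> \<and> f \<omega> = cinner (?a 1) ?d.
        cinner (tensor (?a 1) ?d) (E \<omega> *v tensor (?a 1) ?d)) = 1"
      and "(\<Sum>\<omega> | \<omega> \<in> \<Omega> \<and> f \<omega> = cinner (?a 2) ?d.
        cinner (tensor (?a 2) ?d) (E \<omega> *v tensor (?a 2) ?d)) = 1"
      using correct by blast+
    show "\<not> (f \<omega> = cinner (?a 1) ?d \<and> f \<omega> = cinner (?a 2) ?d)" for \<omega>
      unfolding val1 val2 using ne(1) by (metis of_real_eq_1_iff)
  qed (simp_all only: cinner_tensor unit mult_1_left)
  \<comment> \<open>The shared factor \<open>?d\<close> contributes 1, so the joint overlap is that
    of \<open>?a 1\<close> and \<open>?a 2\<close>.\<close>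
  then have "complex_of_real (2 * \<alpha> * \<beta>) = 0"
    by (simp only: cinner_tensor unit overlap mult_1_right)
  with ne(2) show False by (simp only: of_real_eq_0_iff)
qed

end
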